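(* If $n\geq 1$ then $L(K_{n,n})$ is a connected vertex-transitive CIS graph of order $n^2$ and valency $2(n-1)$ with $\alpha(L(K_{n,n}))=\omega(L(K_{n,n}))=n$.
   Context: $K_{n,n}$ is the complete bipartite graph with both parts of size $n$. $L(\Gamma)$ is the line graph of $\Gamma$: its vertices are the edges of $\Gamma$, two distinct edges being adjacent if and only if they share an endpoint. A clique (respectively, stable set) is a set of pairwise adjacent (respectively, pairwise non-adjacent) vertices; "maximal" means maximal with respect to inclusion. $\omega(\Gamma)$ and $\alpha(\Gamma)$ denote the largest cardinality of a clique and of a stable set of $\Gamma$. A graph is CIS if every maximal stable set and every maximal clique have non-empty intersection. A graph is vertex-transitive if for every pair of vertices there is an automorphism mapping one to the other. A graph has valency $k$ if every vertex has exactly $k$ neighbors; the order is the number of vertices. *)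

theory Defs
  imports "Graph_Theory.Kuratowski" "Graph_Theory.Digraph_Isomorphism"
begin

text \<open>
  As in the Graph_Theory library, a finite simple graph is a \<open>graph\<close>, i.e. a finite symmetric
  digraph without loops and parallel arcs; an undirected edge is a pair of opposite arcs, so
  the edge set consists of the unordered pairs of ends of arcs.
\<close>

definition uedges :: "('a, 'b) pre_digraph \<Rightarrow> 'a set set" where
  "uedges G = {{u, v} | u v. u \<rightarrow>\<^bsub>G\<^esub> v}"

definition line_graph :: "('a, 'b) pre_digraph \<Rightarrow> 'a set pair_pre_digraph" where
  "line_graph G = \<lparr> pverts = uedges G,
     parcs = {(e, f). e \<in> uedges G \<and> f \<in> uedges G \<and> e \<noteq> f \<and> e \<inter> f \<noteq> {}} \<rparr>"

definition is_clique :: "('a, 'b) pre_digraph \<Rightarrow> 'a set \<Rightarrow> bool" where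
  "is_clique G C \<longleftrightarrow> C \<subseteq> verts G \<and> (\<forall>u\<in>C. \<forall>v\<in>C. u \<noteq> v \<longrightarrow> u \<rightarrow>\<^bsub>G\<^esub> v)"

definition is_stable_set :: "('a, 'b) pre_digraph \<Rightarrow> 'a set \<Rightarrow> bool" where
  "is_stable_set G S \<longleftrightarrow> S \<subseteq> verts G \<and> (\<forall>u\<in>S. \<forall>v\<in>S. u \<noteq> v \<longrightarrow> \<not> u \<rightarrow>\<^bsub>G\<^esub> v)"

definition maximal_clique :: "('a, 'b) pre_digraph \<Rightarrow> 'a set \<Rightarrow> bool" where
  "maximal_clique G C \<longleftrightarrow> is_clique G C \<and> (\<forall>D. is_clique G D \<longrightarrow> C \<subseteq> D \<longrightarrow> D = C)"

definition maximal_stable_set :: "('a, 'b) pre_digraph \<Rightarrow> 'a set \<Rightarrow> bool" where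
  "maximal_stable_set G S \<longleftrightarrow>
     is_stable_set G S \<and> (\<forall>T. is_stable_set G T \<longrightarrow> S \<subseteq> T \<longrightarrow> T = S)"

definition clique_number :: "('a, 'b) pre_digraph \<Rightarrow> nat" where
  "clique_number G = Max {card C | C. is_clique G C}"

definition stability_number :: "('a, 'b) pre_digraph \<Rightarrow> nat" where
  "stability_number G = Max {card S | S. is_stable_set G S}"

definition CIS :: "('a, 'b) pre_digraph \<Rightarrow> bool" where
  "CIS G \<longleftrightarrow> (\<forall>S C. maximal_stable_set G S \<longrightarrow> maximal_clique G C \<longrightarrow> S \<inter> C \<noteq> {})"

definition digraph_automorphism ::
    "('a, 'b) pre_digraph \<Rightarrow> ('a, 'b, 'a, 'b) digraph_isomorphism \<Rightarrow> bool" where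
  "digraph_automorphism G h \<longleftrightarrow> pre_digraph.digraph_isomorphism G h \<and> app_iso h G = G"

definition vertex_transitive :: "('a, 'b) pre_digraph \<Rightarrow> bool" where
  "vertex_transitive G \<longleftrightarrow>
     (\<forall>u\<in>verts G. \<forall>v\<in>verts G. \<exists>h. digraph_automorphism G h \<and> iso_verts h u = v)"

definition has_valency :: "('a, 'b) pre_digraph \<Rightarrow> nat \<Rightarrow> bool" where
  "has_valency G k \<longleftrightarrow> (\<forall>v\<in>verts G. card {u \<in> verts G. v \<rightarrow>\<^bsub>G\<^esub> u} = k)"

text \<open>
  The library's \<open>K\<^bsub>m,n\<^esub>\<close> is a predicate characterising the graph up to isomorphism; the following
  witness shows that it is inhabited for all \<open>m\<close> and \<open>n\<close>.
\<close>

lemma complete_bipartite_exists: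
  "K\<^bsub>m,n\<^esub> (with_proj \<lparr> pverts = Inl ` {..<m} \<union> Inr ` {..<n},
     parcs = Inl ` {..<m} \<times> Inr ` {..<n} \<union> Inr ` {..<n} \<times> Inl ` {..<m} \<rparr>)"
  unfolding complete_bipartite_digraph_pair_def
  by (intro conjI exI[of _ "Inl ` {..<m}"] exI[of _ "Inr ` {..<n}"]) (auto simp: card_image)

end

theory Submission
  imports Defs
begin

text \<open>
  The cliques of the line graph are the sets of pairwise intersecting edges, and in a bipartite
  graph these lie in the star of a single vertex; so the maximal cliques are exactly the stars,
  all of size \<open>n\<close>. A stable set is a matching; it covers equally many vertices on both sides. If it
  misses a vertex \<open>x\<close> on one side, it therefore misses some \<open>y\<close> on the other side as well and can be
  enlarged by the edge \<open>xy\<close>. So a maximal stable set is a perfect matching and meets every star.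
\<close>

section \<open>Line graphs\<close>

lemma line_graph_simps [simp]:
  "pverts (line_graph G) = uedges G"
  "(e, f) \<in> parcs (line_graph G) \<longleftrightarrow>
     e \<in> uedges G \<and> f \<in> uedges G \<and> e \<noteq> f \<and> e \<inter> f \<noteq> {}"
  by (auto simp: line_graph_def)

lemma graph_line_graph:
  assumes "finite (uedges G)"
  shows "graph (line_graph G)"
proof -
  have "finite (parcs (line_graph G))"
    by (rule finite_subset[of _ "uedges G \<times> uedges G"]) (use assms in \<open>auto simp: line_graph_def\<close>)
  then interpret pair_graph "line_graph G"
    by unfold_locales (use assms in \<open>auto simp: symmetric_def line_graph_def intro!: symI\<close>)
  show ?thesis
    by (rule pair_graphD_graph)
qed

text \<open>Taking images under a bijection preserves and reflects both distinctness and
  intersection of sets, so adjacency of edges is respected as soon as the edge set is mapped onto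
  itself.\<close>

lemma line_graph_automorphism:
  assumes p: "bij p" and E: "(`) p ` uedges G = uedges G"
  shows "digraph_automorphism (line_graph G)
    \<lparr> iso_verts = image p, iso_arcs = map_prod (image p) (image p), iso_head = snd, iso_tail = fst \<rparr>"
    (is "digraph_automorphism _ ?h")
proof -
  have inj: "inj (image p)" and injp: "inj p"
    using p by (auto simp: bij_def inj_image_eq_iff intro: injI)
  have "map_prod (image p) (image p) ` parcs (line_graph G) = parcs (line_graph G)"
    (is "?m ` ?A = _")
  proof (intro equalityI subsetI)
    fix a assume "a \<in> ?m ` ?A"
    then obtain e f where "a = (p ` e, p ` f)" "(e, f) \<in> ?A"
      by auto
    then show "a \<in> ?A"
      using E by (auto simp: inj_image_eq_iff[OF injp] simp flip: image_Int[OF injp])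
  next
    fix a assume a: "a \<in> ?A"
    obtain e f where ef: "a = (e, f)"
      by (cases a)
    then have "e \<in> (`) p ` uedges G" "f \<in> (`) p ` uedges G"
      using a by (simp_all add: E)
    then obtain e' f' where "e = p ` e'" "f = p ` f'" "e' \<in> uedges G" "f' \<in> uedges G"
      by blast
    then show "a \<in> ?m ` ?A"
      using a ef by (intro rev_image_eqI[of "(e', f')"]) (auto dest: injD[OF injp])
  qed
  moreover have "wf_digraph (line_graph G)"
    by unfold_locales (auto simp: line_graph_def)
  moreover have "inj_on (map_prod (image p) (image p)) (parcs (line_graph G))"
    using map_prod_inj_on[OF inj inj] by (auto intro: inj_on_subset)
  ultimately show ?thesis
    using inj E by (auto simp: digraph_automorphism_def pre_digraph.digraph_isomorphism_def
        app_iso_def with_proj_def intro: inj_on_subset)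
qed

section \<open>The line graph of a complete bipartite graph\<close>

locale complete_bipartite_parts =
  fixes G :: "('a, 'b) pre_digraph" and U V :: "'a set" and n :: nat
  assumes n_pos: "n \<ge> 1"
    and disjoint: "U \<inter> V = {}"
    and card_U: "card U = n"
    and card_V: "card V = n"
    and arcs_ends_eq: "arcs_ends G = U \<times> V \<union> V \<times> U"
begin

text \<open>The assumptions are symmetric in the two parts; facts about matchings proved for
  \<open>U\<close> are transferred to \<open>V\<close> through this.\<close>

lemma swap_parts: "complete_bipartite_parts G V U n"
  using n_pos disjoint card_U card_V arcs_ends_eq by unfold_locales auto

lemma finite_U: "finite U" and finite_V: "finite V"
  using n_pos card_U card_V by (auto intro: card_ge_0_finite)

lemma nonempty_U: "U \<noteq> {}" and nonempty_V: "V \<noteq> {}"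
  using n_pos card_U card_V by auto

lemma uedges_eq: "uedges G = {{u, v} | u v. u \<in> U \<and> v \<in> V}"
  unfolding uedges_def arcs_ends_eq by (auto simp: insert_commute; blast)

lemma edgeE:
  assumes "e \<in> uedges G"
  obtains u v where "e = {u, v}" "u \<in> U" "v \<in> V"
  using assms by (auto simp: uedges_eq)

lemma edgeI: "u \<in> U \<Longrightarrow> v \<in> V \<Longrightarrow> {u, v} \<in> uedges G"
  by (auto simp: uedges_eq)

lemma edge_eq_iff:
  "u \<in> U \<Longrightarrow> v \<in> V \<Longrightarrow> u' \<in> U \<Longrightarrow> v' \<in> V \<Longrightarrow> {u, v} = {u', v'} \<longleftrightarrow> u = u' \<and> v = v'"
  using disjoint by (auto simp: doubleton_eq_iff)

text \<open>The parts are disjoint, so edges can only meet in equal ends on the same side, and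
  sharing both ends would make them equal. Hence the exclusive or: adjacency is that of rook moves
  on the grid \<open>U \<times> V\<close>.\<close>

lemma adjacent_edges_iff:
  assumes "u \<in> U" "v \<in> V" "u' \<in> U" "v' \<in> V"
  shows "({u, v}, {u', v'}) \<in> parcs (line_graph G) \<longleftrightarrow> (u = u') \<noteq> (v = v')"
  using assms disjoint by (auto simp: edgeI edge_eq_iff)

lemma uedges_eq_image: "uedges G = (\<lambda>(u, v). {u, v}) ` (U \<times> V)"
  by (auto simp: uedges_eq)

lemma finite_uedges: "finite (uedges G)"
  by (simp add: uedges_eq_image finite_U finite_V)

lemma card_uedges: "card (uedges G) = n\<^sup>2"
proof -
  have "inj_on (\<lambda>(u, v). {u, v}) (U \<times> V)"
    by (auto simp: inj_on_def edge_eq_iff)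
  then show ?thesis
    by (simp add: uedges_eq_image card_image card_cartesian_product card_U card_V power2_eq_square)
qed

text \<open>The edges \<open>{u, v}\<close> and \<open>{u', v'}\<close> both meet
  \<open>{u, v'}\<close>, which gives a walk of length at most two.\<close>

lemma connected_line_graph: "Digraph_Component.connected (line_graph G)"
proof -
  have "(e, f) \<in> rtrancl_on (uedges G) ((parcs (line_graph G))\<^sup>s)"
    if "e \<in> uedges G" "f \<in> uedges G" for e f
  proof -
    obtain u v u' v' where uv: "e = {u, v}" "u \<in> U" "v \<in> V" and uv': "f = {u', v'}" "u' \<in> U" "v' \<in> V"
      using \<open>e \<in> uedges G\<close> \<open>f \<in> uedges G\<close> by (auto elim!: edgeE)
    let ?R = "(parcs (line_graph G))\<^sup>s" and ?m = "{u, v'}"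
    have m: "?m \<in> uedges G"
      using uv uv' by (auto intro: edgeI)
    \<comment> \<open>Equality is allowed here because \<open>?m\<close> coincides with
      \<open>e\<close> or \<open>f\<close> when the two edges share an end.\<close>
    have step: "(a, b) \<in> rtrancl_on (uedges G) ?R"
      if "a \<in> uedges G" "b \<in> uedges G" "a \<inter> b \<noteq> {}" for a b
    proof (cases "a = b")
      case True
      then show ?thesis
        using that by simp
    next
      case False
      then have "(a, b) \<in> ?R"
        using that by (auto simp: symcl_def)
      then show ?thesis
        using that by (intro rtrancl_on_into_rtrancl_on[OF rtrancl_on_refl]) auto
    qed
    have "(e, ?m) \<in> rtrancl_on (uedges G) ?R" "(?m, f) \<in> rtrancl_on (uedges G) ?R"
      using uv uv' m \<open>e \<in> uedges G\<close> \<open>f \<in> uedges G\<close> by (auto intro!: step)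
    then show ?thesis
      by (rule rtrancl_on_trans)
  qed
  then show ?thesis
    using nonempty_U nonempty_V by (auto simp: connected_conv uedges_eq)
qed

lemma vertex_transitive_line_graph: "vertex_transitive (line_graph G)"
  unfolding vertex_transitive_def
proof (intro ballI)
  fix e f assume "e \<in> verts (line_graph G)" "f \<in> verts (line_graph G)"
  then obtain u v u' v' where
    uv: "e = {u, v}" "u \<in> U" "v \<in> V" and uv': "f = {u', v'}" "u' \<in> U" "v' \<in> V"
    by (auto elim!: edgeE)
  \<comment> \<open>The two transpositions act on different parts, so \<open>p\<close> preserves
    each part and carries \<open>e\<close> to \<open>f\<close>.\<close>
  define p where "p = transpose u u' \<circ> transpose v v'"
  have pU: "p x \<in> U" if "x \<in> U" for x
    using that uv uv' disjoint by (auto simp: p_def transpose_def)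
  have pV: "p x \<in> V" if "x \<in> V" for x
    using that uv uv' disjoint by (auto simp: p_def transpose_def)
  have "bij p"
    unfolding p_def by (intro bij_comp) simp_all
  moreover have "(`) p ` uedges G = uedges G"
  \<comment> \<open>The edge set is finite and taking images is injective, so inclusion already
    gives equality.\<close>
  proof (rule card_subset_eq[OF finite_uedges])
    show "(`) p ` uedges G \<subseteq> uedges G"
      using pU pV by (auto elim!: edgeE intro!: edgeI)
    show "card ((`) p ` uedges G) = card (uedges G)"
      using \<open>bij p\<close> by (intro card_image) (auto simp: inj_on_def bij_def inj_image_eq_iff)
  qed
  ultimately have "digraph_automorphism (line_graph G)
    \<lparr> iso_verts = image p, iso_arcs = map_prod (image p) (image p), iso_head = snd, iso_tail = fst \<rparr>"
    by (rule line_graph_automorphism)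
  moreover have "p ` e = f"
    using uv uv' disjoint by (auto simp: p_def transpose_def)
  ultimately show "\<exists>h. digraph_automorphism (line_graph G) h \<and> iso_verts h e = f"
    by (metis digraph_isomorphism.select_convs(1))
qed

section \<open>Stars, valency and cliques\<close>

definition star :: "'a \<Rightarrow> 'a set set" where
  "star x = {e \<in> uedges G. x \<in> e}"

lemma card_star:
  assumes "x \<in> U \<union> V"
  shows "card (star x) = n"
proof (cases "x \<in> U")
  case True
  then have "star x = (\<lambda>v. {x, v}) ` V"
    using disjoint by (auto simp: star_def uedges_eq)
  then show ?thesis
    by (simp add: card_V card_image inj_on_def doubleton_eq_iff)
next
  case False
  then have "star x = (\<lambda>u. {u, x}) ` U"
    using disjoint assms by (auto simp: star_def uedges_eq)
  then show ?thesis
    by (simp add: card_U card_image inj_on_def doubleton_eq_iff)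
qed

text \<open>The neighbours of \<open>{u, v}\<close> are the other edges of the stars at
  \<open>u\<close> and \<open>v\<close>, and these two stars have only \<open>{u, v}\<close> in
  common.\<close>

lemma has_valency_line_graph: "has_valency (line_graph G) (2 * (n - 1))"
  unfolding has_valency_def
proof
  fix e assume "e \<in> verts (line_graph G)"
  then obtain u v where uv: "e = {u, v}" "u \<in> U" "v \<in> V"
    by (auto elim!: edgeE)
  have e: "e \<in> uedges G"
    using uv by (simp add: edgeI)
  have fin: "finite (star x)" for x
    using finite_uedges by (simp add: star_def)
  have "{f \<in> verts (line_graph G). e \<rightarrow>\<^bsub>line_graph G\<^esub> f} = (star u - {e}) \<union> (star v - {e})"
    using uv e by (auto simp: star_def)
  moreover have "(star u - {e}) \<inter> (star v - {e}) = {}"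
    using uv disjoint by (auto simp: star_def elim!: edgeE)
  moreover have "card (star u - {e}) = n - 1" "card (star v - {e}) = n - 1"
    using uv e card_star by (simp_all add: star_def)
  ultimately show "card {f \<in> verts (line_graph G). e \<rightarrow>\<^bsub>line_graph G\<^esub> f} = 2 * (n - 1)"
    by (simp add: card_Un_disjoint fin)
qed

lemma is_clique_star: "is_clique (line_graph G) (star x)"
  by (auto simp: is_clique_def star_def)

text \<open>Pairwise intersecting edges without a common end would form a triangle, which a
  bipartite graph does not contain.\<close>

lemma clique_subset_star:
  assumes C: "is_clique (line_graph G) C"
  obtains x where "x \<in> U \<union> V" "C \<subseteq> star x"
proof (cases "C = {}")
  case True
  then show ?thesis
    using that nonempty_U by auto
next
  case False
  have adj: "(e, f) \<in> parcs (line_graph G)" if "e \<in> C" "f \<in> C" "e \<noteq> f" for e f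
    using C that by (auto simp: is_clique_def)
  have CE: "C \<subseteq> uedges G"
    using C by (simp add: is_clique_def)
  obtain e u v where e: "e \<in> C" "e = {u, v}" "u \<in> U" "v \<in> V"
    using False CE by (metis edgeE ex_in_conv subsetD)
  show ?thesis
  proof (cases "C \<subseteq> star u")
    case True
    then show ?thesis
      using that e by auto
  next
    case False
    then obtain f where f: "f \<in> C" "u \<notin> f"
      using CE by (auto simp: star_def)
    then obtain u' v' where uv': "f = {u', v'}" "u' \<in> U" "v' \<in> V"
      using CE by (meson edgeE subsetD)
    have "(e, f) \<in> parcs (line_graph G)"
      using e f by (intro adj) auto
    then have "(u = u') \<noteq> (v = v')"
      using e uv' by (simp add: adjacent_edges_iff del: line_graph_simps)
    then have u': "f = {u', v}" "u' \<in> U" "u' \<noteq> u"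
      using f uv' by auto
    \<comment> \<open>An edge avoiding \<open>v\<close> would have to meet both \<open>e\<close> and
      \<open>f\<close> in \<open>U\<close>, so its single end there would equal both
      \<open>u\<close> and \<open>u'\<close>.\<close>
    have "v \<in> g" if "g \<in> C" for g
    proof (rule ccontr)
      assume "v \<notin> g"
      obtain a b where ab: "g = {a, b}" "a \<in> U" "b \<in> V"
        using CE \<open>g \<in> C\<close> by (meson edgeE subsetD)
      have "(e, g) \<in> parcs (line_graph G)" "(f, g) \<in> parcs (line_graph G)"
        using \<open>v \<notin> g\<close> \<open>g \<in> C\<close> e f u' by (auto intro!: adj simp del: line_graph_simps)
      then have "(u = a) \<noteq> (v = b)" "(u' = a) \<noteq> (v = b)"
        using e u' ab by (simp_all add: adjacent_edges_iff del: line_graph_simps)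
      then have "a = u" "a = u'"
        using \<open>v \<notin> g\<close> ab by auto
      then show False
        using u' by simp
    qed
    then show ?thesis
      using that[of v] e CE by (auto simp: star_def)
  qed
qed

text \<open>The star containing the clique is itself a clique, so maximality forces
  equality.\<close>

lemma maximal_clique_is_star:
  assumes "maximal_clique (line_graph G) C"
  obtains x where "x \<in> U \<union> V" "C = star x"
  using assms is_clique_star unfolding maximal_clique_def by (metis clique_subset_star)

lemma clique_number_line_graph: "clique_number (line_graph G) = n"
  unfolding clique_number_def
proof (rule Max_eqI)
  have le: "card C \<le> n" if C: "is_clique (line_graph G) C" for C
  proof -
    obtain x where "x \<in> U \<union> V" "C \<subseteq> star x"
      using clique_subset_star[OF C] .
    then show ?thesis
      using card_star[of x] card_mono[of "star x" C] finite_uedges by (simp add: star_def)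
  qed
  show "finite {card C | C. is_clique (line_graph G) C}"
    by (rule finite_subset[of _ "{..n}"]) (use le in auto)
  show "m \<le> n" if "m \<in> {card C | C. is_clique (line_graph G) C}" for m
    using that le by auto
  obtain x where "x \<in> U"
    using nonempty_U by auto
  then show "n \<in> {card C | C. is_clique (line_graph G) C}"
    using is_clique_star card_star[of x] by auto
qed

section \<open>Stable sets as matchings\<close>

lemma stable_set_iff:
  "is_stable_set (line_graph G) S \<longleftrightarrow>
     S \<subseteq> uedges G \<and> (\<forall>e\<in>S. \<forall>f\<in>S. e \<noteq> f \<longrightarrow> e \<inter> f = {})"
  by (auto simp: is_stable_set_def subset_iff)

text \<open>Each edge has exactly one end in \<open>U\<close>, and disjoint edges have different
  ones. The count serves twice: to compare the covered vertices of the two parts, and to bound the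
  size of a stable set by \<open>n\<close>.\<close>

lemma card_stable_set_covered:
  assumes S: "is_stable_set (line_graph G) S"
  shows "card (\<Union>S \<inter> U) = card S"
proof -
  have sub: "S \<subseteq> uedges G" and disj: "\<And>e f. e \<in> S \<Longrightarrow> f \<in> S \<Longrightarrow> e \<noteq> f \<Longrightarrow> e \<inter> f = {}"
    using S by (auto simp: stable_set_iff)
  have one: "card (e \<inter> U) = 1" if e: "e \<in> S" for e
  proof -
    obtain u v where "e = {u, v}" "u \<in> U" "v \<in> V"
      using e sub by (meson edgeE subsetD)
    then have "e \<inter> U = {u}"
      using disjoint by auto
    then show ?thesis
      by simp
  qed
  have "\<Union>S \<inter> U = (\<Union>e\<in>S. e \<inter> U)"
    by blast
  also have "card \<dots> = (\<Sum>e\<in>S. card (e \<inter> U))"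
    using disj finite_U finite_subset[OF sub finite_uedges] by (intro card_UN_disjoint) blast+
  also have "\<dots> = card S"
    using one by simp
  finally show ?thesis .
qed

lemma maximal_stable_set_covers_U:
  assumes S: "maximal_stable_set (line_graph G) S" and x: "x \<in> U"
  shows "x \<in> \<Union>S"
proof (rule ccontr)
  assume xS: "x \<notin> \<Union>S"
  have stable: "is_stable_set (line_graph G) S"
    using S by (simp add: maximal_stable_set_def)
  have "card (\<Union>S \<inter> V) = card (\<Union>S \<inter> U)"
    using card_stable_set_covered[OF stable]
      complete_bipartite_parts.card_stable_set_covered[OF swap_parts stable] by simp
  also have "\<dots> < card U"
    using x xS finite_U by (intro psubset_card_mono) auto
  finally have "\<Union>S \<inter> V \<noteq> V"
    by (auto simp: card_U card_V)
  then obtain y where y: "y \<in> V" "y \<notin> \<Union>S"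
    by blast
  \<comment> \<open>Both ends of the new edge are uncovered, so it is disjoint from every edge of
    \<open>S\<close>.\<close>
  have "is_stable_set (line_graph G) (insert {x, y} S)"
    using stable x xS y by (auto simp: stable_set_iff edgeI)
  then have "{x, y} \<in> S"
    using S unfolding maximal_stable_set_def by blast
  then show False
    using xS by auto
qed

lemma maximal_stable_set_covers:
  assumes "maximal_stable_set (line_graph G) S" "x \<in> U \<union> V"
  shows "x \<in> \<Union>S"
  using assms maximal_stable_set_covers_U
    complete_bipartite_parts.maximal_stable_set_covers_U[OF swap_parts] by blast

text \<open>The edge of the matching that covers the centre of the star lies in both sets.\<close>

lemma CIS_line_graph: "CIS (line_graph G)"
  unfolding CIS_def
proof (intro allI impI)
  fix S C assume S: "maximal_stable_set (line_graph G) S" and C: "maximal_clique (line_graph G) C"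
  obtain x where x: "x \<in> U \<union> V" "C = star x"
    using maximal_clique_is_star[OF C] .
  moreover have "S \<subseteq> uedges G"
    using S by (simp add: maximal_stable_set_def stable_set_iff)
  ultimately show "S \<inter> C \<noteq> {}"
    using maximal_stable_set_covers[OF S x(1)] by (auto simp: star_def)
qed

lemma stability_number_line_graph: "stability_number (line_graph G) = n"
  unfolding stability_number_def
proof (rule Max_eqI)
  have le: "card S \<le> n" if "is_stable_set (line_graph G) S" for S
    using card_mono[OF finite_U, of "\<Union>S \<inter> U"] card_stable_set_covered[OF that] card_U by simp
  show "finite {card S | S. is_stable_set (line_graph G) S}"
    by (rule finite_subset[of _ "{..n}"]) (use le in auto)
  show "m \<le> n" if "m \<in> {card S | S. is_stable_set (line_graph G) S}" for m
    using that le by auto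
  \<comment> \<open>The graph of a bijection between the parts is a perfect matching, which attains
    the bound.\<close>
  obtain f where f: "bij_betw f U V"
    using finite_same_card_bij[OF finite_U finite_V] card_U card_V by auto
  have fV: "f u \<in> V" if "u \<in> U" for u
    using f that by (auto simp: bij_betw_def)
  let ?S = "(\<lambda>u. {u, f u}) ` U"
  have "is_stable_set (line_graph G) ?S"
    using fV f disjoint by (auto simp: stable_set_iff edgeI bij_betw_def dest: inj_onD)
  moreover have "card ?S = n"
    using fV by (subst card_image) (auto simp: inj_on_def edge_eq_iff card_U)
  ultimately show "n \<in> {card S | S. is_stable_set (line_graph G) S}"
    by blast
qed

end

theorem proposition3p3:
  fixes n :: nat and G :: "('a, 'b) pre_digraph"
  assumes "n \<ge> 1" and "K\<^bsub>n,n\<^esub> G"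
  shows "graph (line_graph G) \<and>
    Digraph_Component.connected (line_graph G) \<and>
    vertex_transitive (line_graph G) \<and>
    CIS (line_graph G) \<and>
    card (verts (line_graph G)) = n\<^sup>2 \<and>
    has_valency (line_graph G) (2 * (n - 1)) \<and>
    stability_number (line_graph G) = n \<and>
    clique_number (line_graph G) = n"
proof -
  obtain U V where "U \<inter> V = {}" "card U = n" "card V = n" "arcs_ends G = U \<times> V \<union> V \<times> U"
    using assms(2) unfolding complete_bipartite_digraph_def by blast
  then interpret complete_bipartite_parts G U V n
    using assms(1) by unfold_locales
  show ?thesis
    using graph_line_graph[OF finite_uedges] connected_line_graph vertex_transitive_line_graph
      CIS_line_graph card_uedges has_valency_line_graph stability_number_line_graph
      clique_number_line_graph by simp
qed

end
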